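(* Let $n\ge2$, let $\mathbf x=(x_1,\dots,x_n)$ with all $x_i>0$, let $D_{\min}>0$, and let $c(\mathbf x)=\sum_{j=1}^n x_j+D_{\min}$. Consider the simple cycle that visits the $n$ locations once each along a minimum Hamiltonian cycle of total travel time $D_{\min}$, searching location $i$ for $x_i$ time units. Then for each $i$ the expected time $f_i(\mathbf x)$ to detect an attacker at location $i$ is $$ f_i(\mathbf x)=\frac1{\lambda_i}+\frac{c(\mathbf x)-x_i}{c(\mathbf x)}\left(\frac1{\lambda_i}-\frac{c(\mathbf x)-x_i}{2}+\frac{c(\mathbf x)-x_i}{1-e^{-\lambda_i x_i}}\right). $$
   Context: The simple cycle is repeated forever; its period is $c(\mathbf x)$, and in each period location $i$ is searched during one interval of length $x_i$ and not searched during the remaining $c(\mathbf x)-x_i$ time units. While the patroller is searching location $i$, an attacker present there is detected at instantaneous rate $\lambda_i>0$; otherwise it is not detected. Thus an attacker who arrives at location $i$ at time $t$ is still undetected at time $t+u$ with probability $e^{-\lambda_iS_i(t,t+u)}$, where $S_i(t,t+u)$ is the time spent searching location $i$ during $[t,t+u]$. The expected time to detect an attacker at location $i$ refers to an arrival time uniform on one period: $f_i(\mathbf x)=\frac1{c(\mathbf x)}\int_0^{c(\mathbf x)}\int_0^\infty e^{-\lambda_iS_i(t,t+u)}\,du\,dt$. *)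

theory Defs
  imports "HOL-Analysis.Analysis" "HOL-Combinatorics.Multiset_Permutations"
begin

text \<open>Locations are \<open>1, \<dots>, n\<close>; \<open>d i j\<close> is the travel time from \<open>i\<close> to \<open>j\<close>.
  A Hamiltonian cycle is a list \<open>vs \<in> permutations_of_set {1..n}\<close>, closed up by the leg from
  its last to its first entry. Travel times need not be symmetric.\<close>

definition tour_time :: "(nat \<Rightarrow> nat \<Rightarrow> real) \<Rightarrow> nat list \<Rightarrow> real" where
  "tour_time d vs = (\<Sum>k<length vs. d (vs ! k) (vs ! (Suc k mod length vs)))"

definition min_tour_time :: "(nat \<Rightarrow> nat \<Rightarrow> real) \<Rightarrow> nat \<Rightarrow> real" where
  "min_tour_time d n = Min (tour_time d ` permutations_of_set {1..n})"

definition period :: "(nat \<Rightarrow> nat \<Rightarrow> real) \<Rightarrow> nat \<Rightarrow> (nat \<Rightarrow> real) \<Rightarrow> real" where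
  "period d n x = (\<Sum>j=1..n. x j) + min_tour_time d n"

text \<open>The patroller starts searching \<open>vs ! 0\<close> at time 0; \<open>search_start d x vs k\<close> is the time
  at which the search of \<open>vs ! k\<close> begins in the first period.\<close>

definition search_start ::
  "(nat \<Rightarrow> nat \<Rightarrow> real) \<Rightarrow> (nat \<Rightarrow> real) \<Rightarrow> nat list \<Rightarrow> nat \<Rightarrow> real" where
  "search_start d x vs k = (\<Sum>j<k. x (vs ! j) + d (vs ! j) (vs ! Suc j))"

definition searched ::
  "(nat \<Rightarrow> nat \<Rightarrow> real) \<Rightarrow> nat \<Rightarrow> (nat \<Rightarrow> real) \<Rightarrow> nat list \<Rightarrow> nat \<Rightarrow> real set" where
  "searched d n x vs i =
     (\<Union>k\<in>{k. k < length vs \<and> vs ! k = i}. \<Union>m::nat.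
        {real m * period d n x + search_start d x vs k ..
         real m * period d n x + search_start d x vs k + x i})"

definition search_time ::
  "(nat \<Rightarrow> nat \<Rightarrow> real) \<Rightarrow> nat \<Rightarrow> (nat \<Rightarrow> real) \<Rightarrow> nat list \<Rightarrow> nat \<Rightarrow> real \<Rightarrow> real \<Rightarrow> real" where
  "search_time d n x vs i s t = measure lborel ({s..t} \<inter> searched d n x vs i)"

text \<open>The integrals are of nonnegative functions and hence taken in \<open>[0, \<infinity>]\<close>, so that no
  integrability side condition or default value is involved.\<close>

definition expected_detection_time ::
  "(nat \<Rightarrow> nat \<Rightarrow> real) \<Rightarrow> nat \<Rightarrow> (nat \<Rightarrow> real) \<Rightarrow> (nat \<Rightarrow> real) \<Rightarrow> nat list \<Rightarrow> nat \<Rightarrow> ereal" where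
  "expected_detection_time d n lam x vs i =
     ereal (1 / period d n x) *
     enn2ereal (\<integral>\<^sup>+ t \<in> {0..period d n x}.
       (\<integral>\<^sup>+ u \<in> {0..}. ennreal (exp (- lam i * search_time d n x vs i t (t + u))) \<partial>lborel)
       \<partial>lborel)"

end

theory Submission
  imports Defs
begin

text \<open>
  Only the location \<open>i\<close> of the attack matters: seen from there, the patrol is a periodic pattern
  that searches during \<open>[s + m C, s + m C + x]\<close> for \<open>m = 0, 1, \<dots>\<close>, where \<open>C\<close> is the
  period, \<open>x\<close> the search time and \<open>s\<close> the first start. Because the tour visits \<open>i\<close> once and travel times are
  nonnegative, \<open>s \<ge> 0\<close> and \<open>s + x \<le> C\<close>, so that the first period contains one full search
  and no part of another (\<open>search_end_le_period\<close>).

  Let \<open>G t\<close> be the mean delay until detection after an arrival at time \<open>t\<close>. Detection is memoryless,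
  so \<open>G t\<close> is the mean time spent undetected in \<open>[t, r]\<close> plus the probability of surviving
  until \<open>r\<close> times \<open>G r\<close> (\<open>mean_delay_renewal\<close>). With \<open>q = exp (- \<lambda> x)\<close>, one
  period contributes \<open>K = (1 - q) / \<lambda> + q (C - x)\<close> to the delay of an attacker
  undetected at its start, and is survived with probability \<open>q\<close>. Hence
  \<open>G = K (1 + q + q\<^sup>2 + \<dots>) = H\<close> at every search start, where
  \<open>H = 1 / \<lambda> + q (C - x) / (1 - q)\<close> (\<open>mean_delay_start\<close>). The
  equation \<open>H = K + q H\<close> alone would not do, since \<open>\<infinity>\<close> solves it as well.

  The value at the starts determines \<open>G\<close> in between. An arrival in a gap, at distance \<open>w\<close>
  from the next start, has delay \<open>w + H\<close>. An arrival during a search with \<open>y\<close> left of it has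
  delay \<open>(1 - exp (- \<lambda> y)) / \<lambda> + exp (- \<lambda> y) (C - x + H)\<close>. Integrating
  over a period and using \<open>C - x + H - 1 / \<lambda> = (C - x) / (1 - q)\<close> gives
  \<open>C / \<lambda> + (C - x) ((C - x) / 2 + H)\<close>; division by \<open>C\<close> yields the formula.
\<close>

section \<open>Integrals over intervals\<close>

text \<open>Adjacent closed intervals share an endpoint, which is a null set; hence the single point \<open>p\<close> of overlap.\<close>

lemma nn_integral_AE_disjoint_Un:
  fixes f :: "real \<Rightarrow> ennreal"
  assumes [measurable]: "f \<in> borel_measurable borel" "A \<in> sets borel" "B \<in> sets borel"
    and "A \<inter> B \<subseteq> {p}"
  shows "(\<integral>\<^sup>+v\<in>A \<union> B. f v \<partial>lborel) = (\<integral>\<^sup>+v\<in>A. f v \<partial>lborel) + (\<integral>\<^sup>+v\<in>B. f v \<partial>lborel)"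
proof -
  have "(\<integral>\<^sup>+v\<in>A \<union> B. f v \<partial>lborel) = (\<integral>\<^sup>+v. f v * indicator A v + f v * indicator B v \<partial>lborel)"
  proof (rule nn_integral_cong_AE)
    show "AE v in lborel. f v * indicator (A \<union> B) v = f v * indicator A v + f v * indicator B v"
      using AE_lborel_singleton[of p]
      by eventually_elim (use assms(4) in \<open>auto split: split_indicator\<close>)
  qed
  then show ?thesis
    by (simp add: nn_integral_add)
qed

lemma nn_integral_split_Icc:
  fixes f :: "real \<Rightarrow> ennreal"
  assumes "f \<in> borel_measurable borel" "a \<le> b" "b \<le> c"
  shows "(\<integral>\<^sup>+v\<in>{a..c}. f v \<partial>lborel) = (\<integral>\<^sup>+v\<in>{a..b}. f v \<partial>lborel) + (\<integral>\<^sup>+v\<in>{b..c}. f v \<partial>lborel)"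
  using nn_integral_AE_disjoint_Un[OF assms(1), of "{a..b}" "{b..c}" b] assms(2,3)
  by (simp add: ivl_disj_un_two_touch)

lemma set_nn_integral_const_Icc:
  assumes "a \<le> b" "0 \<le> c"
  shows "(\<integral>\<^sup>+v\<in>{a..b}. ennreal c \<partial>lborel) = ennreal (c * (b - a))"
  using assms by (simp add: nn_integral_cmult_indicator ennreal_mult)

lemma set_nn_integral_cong_real:
  fixes f g :: "real \<Rightarrow> real"
  assumes "\<And>v. v \<in> A \<Longrightarrow> f v = g v"
  shows "(\<integral>\<^sup>+v\<in>A. ennreal (f v) \<partial>lborel) = (\<integral>\<^sup>+v\<in>A. ennreal (g v) \<partial>lborel)"
  by (rule nn_integral_cong) (use assms in \<open>auto split: split_indicator\<close>)

lemma set_nn_integral_exp_Icc: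
  fixes l :: real
  assumes "a \<le> b" "0 < l"
  shows "(\<integral>\<^sup>+v\<in>{a..b}. ennreal (exp (- l * (v - a))) \<partial>lborel) = ennreal ((1 - exp (- l * (b - a))) / l)"
proof -
  have "(\<integral>\<^sup>+v\<in>{a..b}. ennreal (exp (- l * (v - a))) \<partial>lborel)
    = ennreal ((- exp (- l * (b - a)) / l) - (- exp (- l * (a - a)) / l))"
    by (rule nn_integral_FTC_Icc) (use assms in \<open>auto intro!: derivative_eq_intros\<close>)
  then show ?thesis
    by (simp add: diff_divide_distrib)
qed

lemma set_nn_integral_linear_Icc:
  fixes a b c :: real
  assumes "a \<le> b" "b \<le> c"
  shows "(\<integral>\<^sup>+v\<in>{a..b}. ennreal (c - v) \<partial>lborel) = ennreal (((c - a)\<^sup>2 - (c - b)\<^sup>2) / 2)"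
proof -
  have "(\<integral>\<^sup>+v\<in>{a..b}. ennreal (c - v) \<partial>lborel) = ennreal ((- (c - b)\<^sup>2 / 2) - (- (c - a)\<^sup>2 / 2))"
    by (rule nn_integral_FTC_Icc) (use assms in \<open>auto intro!: derivative_eq_intros simp: field_simps\<close>)
  then show ?thesis
    by (simp add: diff_divide_distrib)
qed

section \<open>Search time of a periodic pattern\<close>

locale periodic_search =
  fixes C s x lam :: real
  assumes s: "0 \<le> s" and x: "0 < x" and C: "s + x \<le> C" and lam: "0 < lam"
begin

definition start :: "nat \<Rightarrow> real" where "start m = real m * C + s"

definition searching :: "real set" where "searching = (\<Union>m. {start m .. start m + x})"

definition search_between :: "real \<Rightarrow> real \<Rightarrow> real" where
  "search_between a b = measure lborel ({a..b} \<inter> searching)"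

abbreviation miss :: real where "miss \<equiv> exp (- lam * x)"

lemma miss: "0 < miss" "miss < 1"
  using x lam by simp_all

lemma miss_neq: "1 - miss \<noteq> 0"
  using miss by linarith

lemma C_pos: "0 < C"
  using s x C by linarith

lemma start_add: "start (k + m) = start k + real m * C"
  by (simp add: start_def algebra_simps)

lemma start_Suc: "start (Suc m) = start m + C"
  by (simp add: start_def algebra_simps)

lemma start_mono: "m \<le> k \<Longrightarrow> start m \<le> start k"
  using C_pos by (simp add: start_def)

lemma searching_borel [measurable]: "searching \<in> sets borel"
  by (simp add: searching_def)

lemma fmeasurable_search: "{a..b} \<inter> searching \<in> fmeasurable lborel"
proof (rule fmeasurableI2)
  show "{a..b} \<in> fmeasurable lborel"
    by (rule fmeasurableI) (simp_all add: emeasure_lborel_Icc_eq)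
qed auto

lemma search_between_mono: "b \<le> c \<Longrightarrow> search_between a b \<le> search_between a c"
  unfolding search_between_def
  by (rule measure_mono_fmeasurable) (auto simp: fmeasurable_search)

lemma search_between_add:
  assumes "a \<le> b" "b \<le> c"
  shows "search_between a c = search_between a b + search_between b c"
proof -
  have eq: "{a..c} \<inter> searching = ({a..b} \<inter> searching) \<union> ({b..c} \<inter> searching)"
    using assms by auto
  have "measure lborel (({a..b} \<inter> searching) \<inter> ({b..c} \<inter> searching)) \<le> measure lborel {b}"
    by (rule measure_mono_fmeasurable) (auto intro!: fmeasurableI)
  then have "measure lborel (({a..b} \<inter> searching) \<inter> ({b..c} \<inter> searching)) = 0"
    by (simp add: measure_le_0_iff)
  then show ?thesis
    unfolding search_between_def eq
    by (subst measure_Un3) (auto simp: fmeasurable_search)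
qed

lemma search_between_inside:
  assumes "start m \<le> a" "a \<le> b" "b \<le> start m + x"
  shows "search_between a b = b - a"
proof -
  have "{a..b} \<inter> searching = {a..b}"
    using assms by (auto simp: searching_def intro!: exI[of _ m])
  then show ?thesis
    using assms by (simp add: search_between_def)
qed

lemma search_between_outside:
  assumes "a \<le> b" "{a<..<b} \<inter> searching = {}"
  shows "search_between a b = 0"
proof -
  have "measure lborel ({a..b} \<inter> searching) \<le> measure lborel {a, b}"
  proof (rule measure_mono_fmeasurable)
    show "{a..b} \<inter> searching \<subseteq> {a, b}"
      using assms by (auto simp: disjoint_iff) (metis greaterThanLessThan_iff less_eq_real_def)
  qed (auto intro!: fmeasurableI simp: emeasure_lborel_countable)
  also have "\<dots> = 0"
    by (simp add: measure_def emeasure_lborel_countable)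
  finally show ?thesis
    by (simp add: search_between_def measure_le_0_iff)
qed

lemma search_between_gap:
  assumes "start m + x \<le> a" "a \<le> b" "b \<le> start (Suc m)"
  shows "search_between a b = 0"
proof (rule search_between_outside)
  show "{a<..<b} \<inter> searching = {}"
  proof (rule ccontr)
    assume "{a<..<b} \<inter> searching \<noteq> {}"
    then obtain v k where v: "a < v" "v < b" "start k \<le> v" "v \<le> start k + x"
      by (auto simp: searching_def)
    then show False
      using start_mono[of k m] start_mono[of "Suc m" k] assms by (cases "k \<le> m") auto
  qed
qed fact

lemma search_between_before:
  assumes "a \<le> b" "b \<le> start 0"
  shows "search_between a b = 0"
proof (rule search_between_outside)
  show "{a<..<b} \<inter> searching = {}"
  proof (rule ccontr)
    assume "{a<..<b} \<inter> searching \<noteq> {}"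
    then obtain v k where "v < b" "start k \<le> v"
      by (auto simp: searching_def)
    then show False
      using start_mono[of 0 k] assms by simp
  qed
qed fact

lemma search_between_starts: "search_between (start k) (start (k + m)) = real m * x"
proof (induction m)
  case 0
  then show ?case using search_between_inside[of k "start k" "start k"] x by simp
next
  case (Suc m)
  let ?a = "start (k + m)"
  have a: "?a \<le> ?a + x" "?a + x \<le> start (Suc (k + m))"
    using x C s by (auto simp: start_Suc)
  then have "search_between ?a (start (Suc (k + m)))
      = search_between ?a (?a + x) + search_between (?a + x) (start (Suc (k + m)))"
    by (rule search_between_add)
  also have "\<dots> = x"
    using search_between_inside[of "k + m" ?a "?a + x"] search_between_gap[of "k + m"] a by simp
  finally show ?case
    using search_between_add[of "start k" ?a "start (Suc (k + m))"] Suc a start_mono[of k "k + m"]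
    by (simp add: algebra_simps)
qed

section \<open>Mean delay until detection\<close>

lemma search_between_measurable [measurable]: "search_between t \<in> borel_measurable borel"
  by (rule borel_measurable_mono) (simp add: mono_def search_between_mono)

lemma measurable_survival:
  "(\<lambda>v. ennreal (exp (- lam * search_between t v))) \<in> borel_measurable borel"
  by measurable

lemma survival_add:
  assumes "t \<le> r" "r \<le> v"
  shows "ennreal (exp (- lam * search_between t v))
    = ennreal (exp (- lam * search_between t r)) * ennreal (exp (- lam * search_between r v))"
proof -
  have "exp (- lam * search_between t v)
      = exp (- lam * search_between t r) * exp (- lam * search_between r v)"
    using search_between_add[OF assms] by (simp add: ring_distribs flip: exp_add)
  then show ?thesis
    by (simp only: ennreal_mult exp_ge_zero)
qed

lemma set_nn_integral_survival_shift:
  assumes "t \<le> r" "A \<subseteq> {r..}" and [measurable]: "A \<in> sets borel"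
  shows "(\<integral>\<^sup>+v\<in>A. ennreal (exp (- lam * search_between t v)) \<partial>lborel)
    = ennreal (exp (- lam * search_between t r)) *
      (\<integral>\<^sup>+v\<in>A. ennreal (exp (- lam * search_between r v)) \<partial>lborel)"
proof -
  have "(\<integral>\<^sup>+v\<in>A. ennreal (exp (- lam * search_between t v)) \<partial>lborel)
    = (\<integral>\<^sup>+v. ennreal (exp (- lam * search_between t r)) *
        (ennreal (exp (- lam * search_between r v)) * indicator A v) \<partial>lborel)"
  proof (rule nn_integral_cong)
    fix v
    show "ennreal (exp (- lam * search_between t v)) * indicator A v
      = ennreal (exp (- lam * search_between t r)) *
        (ennreal (exp (- lam * search_between r v)) * indicator A v)"
      using survival_add[OF assms(1), of v] assms(2) by (cases "v \<in> A") auto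
  qed
  then show ?thesis
    by (simp add: nn_integral_cmult)
qed

text \<open>The delay as the integral of its tail probability, over absolute time \<open>v\<close> instead of the elapsed
  time \<open>v - t\<close>, so that splitting the range at a later time needs no shift.\<close>

definition mean_delay :: "real \<Rightarrow> ennreal" where
  "mean_delay t = (\<integral>\<^sup>+v\<in>{t..}. ennreal (exp (- lam * search_between t v)) \<partial>lborel)"

text \<open>Memorylessness: survival until \<open>v \<ge> r\<close> factors through survival until \<open>r\<close>.\<close>

lemma mean_delay_renewal:
  assumes "t \<le> r"
  shows "mean_delay t = (\<integral>\<^sup>+v\<in>{t..r}. ennreal (exp (- lam * search_between t v)) \<partial>lborel)
    + ennreal (exp (- lam * search_between t r)) * mean_delay r"
proof -
  have "{t..} = {t..r} \<union> {r..}"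
    using assms by auto
  then have "mean_delay t = (\<integral>\<^sup>+v\<in>{t..r}. ennreal (exp (- lam * search_between t v)) \<partial>lborel)
    + (\<integral>\<^sup>+v\<in>{r..}. ennreal (exp (- lam * search_between t v)) \<partial>lborel)"
    unfolding mean_delay_def
    using nn_integral_AE_disjoint_Un[OF measurable_survival, of "{t..r}" "{r..}" r t] by fastforce
  then show ?thesis
    using set_nn_integral_survival_shift[OF assms, of "{r..}"] by (simp add: mean_delay_def)
qed

lemma mean_delay_idle:
  assumes "t \<le> r" "search_between t r = 0"
  shows "mean_delay t = ennreal (r - t) + mean_delay r"
proof -
  have "search_between t v = 0" if "v \<in> {t..r}" for v
    using search_between_mono[of v r t] that assms(2)
    by (simp add: search_between_def measure_le_0_iff)
  then have "(\<integral>\<^sup>+v\<in>{t..r}. ennreal (exp (- lam * search_between t v)) \<partial>lborel)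
      = (\<integral>\<^sup>+v\<in>{t..r}. ennreal 1 \<partial>lborel)"
    by (intro set_nn_integral_cong_real) simp
  also have "\<dots> = ennreal (r - t)"
    using set_nn_integral_const_Icc[of t r 1] assms(1) by simp
  finally show ?thesis
    using mean_delay_renewal[OF assms(1)] assms(2) by simp
qed

lemma mean_delay_search:
  assumes "start m \<le> t" "t \<le> start m + x"
  shows "mean_delay t = ennreal ((1 - exp (- lam * (start m + x - t))) / lam)
    + ennreal (exp (- lam * (start m + x - t))) * mean_delay (start m + x)"
proof -
  have "(\<integral>\<^sup>+v\<in>{t..start m + x}. ennreal (exp (- lam * search_between t v)) \<partial>lborel)
      = (\<integral>\<^sup>+v\<in>{t..start m + x}. ennreal (exp (- lam * (v - t))) \<partial>lborel)"
    by (rule set_nn_integral_cong_real) (use assms in \<open>simp add: search_between_inside\<close>)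
  also have "\<dots> = ennreal ((1 - exp (- lam * (start m + x - t))) / lam)"
    by (rule set_nn_integral_exp_Icc) (use assms lam in auto)
  finally show ?thesis
    using mean_delay_renewal[OF assms(2)] assms by (simp add: search_between_inside[of m])
qed

text \<open>The mean time spent undetected during one period by an attacker present at its start: first
  the search with its exponential survival, then the whole gap with probability \<open>miss\<close>.\<close>

definition per_cycle :: real where "per_cycle = (1 - miss) / lam + miss * (C - x)"

lemma per_cycle_nonneg: "0 \<le> per_cycle"
  using miss lam C s by (simp add: per_cycle_def)

lemma set_nn_integral_cycle:
  "(\<integral>\<^sup>+v\<in>{start m..start (Suc m)}. ennreal (exp (- lam * search_between (start m) v)) \<partial>lborel)
    = ennreal per_cycle"
proof -
  let ?a = "start m" and ?b = "start m + x" and ?c = "start (Suc m)"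
  have le: "?a \<le> ?b" "?b \<le> ?c" using x C s by (auto simp: start_Suc)
  have 1: "(\<integral>\<^sup>+v\<in>{?a..?b}. ennreal (exp (- lam * search_between ?a v)) \<partial>lborel)
      = ennreal ((1 - miss) / lam)"
  proof -
    have "(\<integral>\<^sup>+v\<in>{?a..?b}. ennreal (exp (- lam * search_between ?a v)) \<partial>lborel)
        = (\<integral>\<^sup>+v\<in>{?a..?b}. ennreal (exp (- lam * (v - ?a))) \<partial>lborel)"
      by (rule set_nn_integral_cong_real) (simp add: search_between_inside[of m])
    also have "\<dots> = ennreal ((1 - exp (- lam * (?b - ?a))) / lam)"
      by (rule set_nn_integral_exp_Icc) (use le lam in auto)
    finally show ?thesis by simp
  qed
  have 2: "(\<integral>\<^sup>+v\<in>{?b..?c}. ennreal (exp (- lam * search_between ?a v)) \<partial>lborel)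
      = ennreal (miss * (C - x))"
  proof -
    have "search_between ?a v = x" if "v \<in> {?b..?c}" for v
      using search_between_add[of ?a ?b v] search_between_inside[of m ?a ?b]
        search_between_gap[of m ?b v] le that by simp
    then have "(\<integral>\<^sup>+v\<in>{?b..?c}. ennreal (exp (- lam * search_between ?a v)) \<partial>lborel)
        = (\<integral>\<^sup>+v\<in>{?b..?c}. ennreal miss \<partial>lborel)"
      by (intro set_nn_integral_cong_real) simp
    also have "\<dots> = ennreal (miss * (?c - ?b))"
      by (rule set_nn_integral_const_Icc) (use le in auto)
    finally show ?thesis by (simp add: start_Suc algebra_simps)
  qed
  show ?thesis
    using nn_integral_split_Icc[OF measurable_survival[of ?a] le] 1 2 miss lam C s
    by (simp add: per_cycle_def)
qed

lemma atLeast_start_eq: "{start k..} = (\<Union>m. {start (k + m)..<start (Suc (k + m))})"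
proof (intro equalityI subsetI)
  fix v assume "v \<in> {start k..}"
  then have v: "0 \<le> (v - start k) / C" using C_pos by simp
  define m where "m = nat \<lfloor>(v - start k) / C\<rfloor>"
  have "real m \<le> (v - start k) / C" "(v - start k) / C < real m + 1"
    using v unfolding m_def by linarith+
  then have "v \<in> {start (k + m)..<start (Suc (k + m))}"
    using C_pos by (simp add: start_Suc start_add field_simps)
  then show "v \<in> (\<Union>m. {start (k + m)..<start (Suc (k + m))})" by blast
next
  fix v assume "v \<in> (\<Union>m. {start (k + m)..<start (Suc (k + m))})"
  then obtain m where "start (k + m) \<le> v" by auto
  with start_mono[of k "k + m"] show "v \<in> {start k..}" by simp
qed

text \<open>The sum \<open>per_cycle * (1 + miss + miss ^ 2 + \<dots>)\<close> of the contributions of the successive periods.\<close>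

definition delay_at_start :: real where "delay_at_start = 1 / lam + (C - x) * miss / (1 - miss)"

lemma delay_at_start_eq: "delay_at_start = 1 / lam - (C - x) + (C - x) / (1 - miss)"
proof -
  have "b * q / (1 - q) = b / (1 - q) - b" if "1 - q \<noteq> 0" for b q :: real
    using that by (simp add: field_simps)
  from this[OF miss_neq] show ?thesis
    by (simp only: delay_at_start_def)
qed

lemma delay_at_start_nonneg: "0 \<le> delay_at_start"
  using miss lam C s by (simp add: delay_at_start_def)

text \<open>Surviving \<open>m\<close> periods has probability \<open>miss ^ m\<close>, and the delay in the next one is
  \<open>per_cycle\<close>. Summing over all periods, rather than solving the renewal equation, also proves the
  mean delay finite.\<close>

lemma mean_delay_start: "mean_delay (start k) = ennreal delay_at_start"
proof -
  let ?f = "\<lambda>v. ennreal (exp (- lam * search_between (start k) v))"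
  let ?A = "\<lambda>m. {start (k + m)..<start (Suc (k + m))}"
  have disj: "disjoint_family ?A"
    unfolding disjoint_family_on_def
  proof (intro ballI impI)
    fix m l :: nat assume "m \<noteq> l"
    then show "?A m \<inter> ?A l = {}"
      using start_mono[of "Suc (k + m)" "k + l"] start_mono[of "Suc (k + l)" "k + m"]
      by (cases "m < l") auto
  qed
  have piece: "(\<integral>\<^sup>+v\<in>?A m. ?f v \<partial>lborel) = ennreal (miss ^ m * per_cycle)" for m
  proof -
    let ?I = "{start (k + m)..start (Suc (k + m))}"
    have "(\<integral>\<^sup>+v\<in>?A m. ?f v \<partial>lborel) = (\<integral>\<^sup>+v\<in>?I. ?f v \<partial>lborel)"
    proof (rule nn_integral_cong_AE)
      show "AE v in lborel. ?f v * indicator (?A m) v = ?f v * indicator ?I v"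
        using AE_lborel_singleton[of "start (Suc (k + m))"]
        by eventually_elim (auto split: split_indicator)
    qed
    also have "\<dots> = ennreal (exp (- lam * (real m * x))) * ennreal per_cycle"
      using set_nn_integral_survival_shift[of "start k" "start (k + m)" ?I]
      by (simp add: start_mono set_nn_integral_cycle[simplified] search_between_starts)
    also have "exp (- lam * (real m * x)) = miss ^ m"
      by (simp add: algebra_simps flip: exp_of_nat_mult)
    finally show ?thesis
      using miss per_cycle_nonneg by (simp add: ennreal_mult)
  qed
  \<comment> \<open>Countable additivity of the integral over the periods is that of the measure with this density.\<close>
  have "mean_delay (start k) = emeasure (density lborel ?f) (\<Union>m. ?A m)"
    unfolding mean_delay_def atLeast_start_eq by (subst emeasure_density) auto
  also have "\<dots> = (\<Sum>m. emeasure (density lborel ?f) (?A m))"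
    by (rule suminf_emeasure[symmetric]) (use disj in auto)
  also have "\<dots> = (\<Sum>m. ennreal (miss ^ m * per_cycle))"
    using piece by (simp add: emeasure_density)
  also have "\<dots> = ennreal (1 / (1 - miss) * per_cycle)"
  proof (rule suminf_ennreal_eq)
    show "(\<lambda>m. miss ^ m * per_cycle) sums (1 / (1 - miss) * per_cycle)"
      by (intro sums_mult2 geometric_sums) (use miss in auto)
  qed (use per_cycle_nonneg in simp)
  also have "1 / (1 - miss) * per_cycle = delay_at_start"
    using miss_neq lam by (simp add: per_cycle_def delay_at_start_def add_divide_distrib distrib_left mult.commute)
  finally show ?thesis .
qed

section \<open>Averaging over the arrival time\<close>

lemma mean_delay_before:
  assumes "0 \<le> t" "t \<le> s"
  shows "mean_delay t = ennreal (s + delay_at_start - t)"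
proof -
  have "mean_delay t = ennreal (start 0 - t) + mean_delay (start 0)"
    by (rule mean_delay_idle) (use assms in \<open>auto simp: search_between_before start_def\<close>)
  then show ?thesis
    unfolding mean_delay_start
    using assms delay_at_start_nonneg by (simp add: start_def algebra_simps flip: ennreal_plus)
qed

lemma mean_delay_after:
  assumes "s + x \<le> t" "t \<le> C"
  shows "mean_delay t = ennreal (C + s + delay_at_start - t)"
proof -
  have "mean_delay t = ennreal (start 1 - t) + mean_delay (start 1)"
    by (rule mean_delay_idle)
      (use assms s search_between_gap[of 0 t "start 1"] in \<open>auto simp: start_def\<close>)
  then show ?thesis
    unfolding mean_delay_start
    using assms delay_at_start_nonneg s by (simp add: start_def algebra_simps flip: ennreal_plus)
qed

lemma mean_delay_during:
  assumes "s \<le> t" "t \<le> s + x"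
  shows "mean_delay t = ennreal ((1 - exp (- lam * (s + x - t))) / lam
    + exp (- lam * (s + x - t)) * (C - x + delay_at_start))"
proof -
  have 1: "exp (- lam * (s + x - t)) \<le> 1"
    using assms lam by simp
  have "mean_delay t = ennreal ((1 - exp (- lam * (s + x - t))) / lam)
    + ennreal (exp (- lam * (s + x - t))) * mean_delay (s + x)"
    using mean_delay_search[of 0 t] assms by (simp add: start_def)
  also have "mean_delay (s + x) = ennreal (C - x + delay_at_start)"
    using mean_delay_after[of "s + x"] C by (simp add: algebra_simps)
  also have "ennreal (exp (- lam * (s + x - t))) * ennreal (C - x + delay_at_start)
      = ennreal (exp (- lam * (s + x - t)) * (C - x + delay_at_start))"
    using C s delay_at_start_nonneg by (intro ennreal_mult[symmetric]) auto
  also have "ennreal ((1 - exp (- lam * (s + x - t))) / lam) + \<dots>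
      = ennreal ((1 - exp (- lam * (s + x - t))) / lam + exp (- lam * (s + x - t)) * (C - x + delay_at_start))"
    using C s delay_at_start_nonneg 1 lam by (intro ennreal_plus[symmetric]) auto
  finally show ?thesis .
qed

text \<open>The constant part of the delay gives \<open>x / lam\<close>. The coefficient of the exponential part is
  \<open>C - x + delay_at_start - 1 / lam = (C - x) / (1 - miss)\<close>, and its denominator cancels against the integral of
  the exponential, so this piece is free of \<open>miss\<close>.\<close>

lemma set_nn_integral_during:
  "(\<integral>\<^sup>+t\<in>{s..s + x}. mean_delay t \<partial>lborel) = ennreal (x / lam + (C - x) / lam)"
proof -
  define J where "J = C - x + delay_at_start"
  let ?e = "\<lambda>t. exp (- lam * (s + x - t))"
  let ?F = "\<lambda>t. t / lam + (J - 1 / lam) * ?e t / lam"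
  have J: "0 \<le> J" using delay_at_start_nonneg C s by (simp add: J_def)
  have "J - 1 / lam = (C - x) / (1 - miss)"
    using delay_at_start_eq by (simp add: J_def)
  then have J': "(J - 1 / lam) * (1 - miss) = C - x"
    using miss_neq by simp
  have "(\<integral>\<^sup>+t\<in>{s..s + x}. mean_delay t \<partial>lborel)
      = (\<integral>\<^sup>+t. ennreal ((1 - ?e t) / lam + ?e t * J) * indicator {s..s + x} t \<partial>lborel)"
    by (rule nn_integral_cong) (auto simp: mean_delay_during J_def split: split_indicator)
  also have "\<dots> = ennreal (?F (s + x) - ?F s)"
  proof (rule nn_integral_FTC_Icc)
    show "(?F has_real_derivative (1 - ?e t) / lam + ?e t * J) (at t)" for t
      using lam by (auto intro!: derivative_eq_intros simp: field_simps)
    show "0 \<le> (1 - ?e t) / lam + ?e t * J" if "t \<in> {s..s + x}" for t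
      using that lam J by (intro add_nonneg_nonneg divide_nonneg_pos) auto
  qed (use x in auto)
  also have "?F (s + x) - ?F s = x / lam + (J - 1 / lam) * (1 - miss) / lam"
    using lam by (simp add: diff_divide_distrib add_divide_distrib right_diff_distrib)
  finally show ?thesis
    unfolding J' .
qed

lemma set_nn_integral_mean_delay:
  "(\<integral>\<^sup>+t\<in>{0..C}. mean_delay t \<partial>lborel)
    = ennreal (C / lam + (C - x) * ((C - x) / 2 + delay_at_start))"
proof -
  \<comment> \<open>An explicit version of the delay on the period; it supplies the measurability needed
    to split the integral at \<open>s\<close> and \<open>s + x\<close>.\<close>
  define g where "g t = (if t < s then s + delay_at_start - t else if t < s + x then
    (1 - exp (- lam * (s + x - t))) / lam + exp (- lam * (s + x - t)) * (C - x + delay_at_start)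
    else C + s + delay_at_start - t)" for t
  have [measurable]: "g \<in> borel_measurable borel"
    unfolding g_def by measurable
  have g: "mean_delay t = ennreal (g t)" if "0 \<le> t" "t \<le> C" for t
    using that mean_delay_before[of t] mean_delay_during[of t] mean_delay_after[of t]
    by (simp add: g_def)
  have g_integral: "(\<integral>\<^sup>+t\<in>{a..b}. ennreal (g t) \<partial>lborel) = (\<integral>\<^sup>+t\<in>{a..b}. mean_delay t \<partial>lborel)"
    if "0 \<le> a" "b \<le> C" for a b
    by (rule nn_integral_cong) (use that in \<open>auto simp: g split: split_indicator\<close>)
  have "(\<integral>\<^sup>+t\<in>{0..C}. mean_delay t \<partial>lborel)
    = (\<integral>\<^sup>+t\<in>{0..s}. mean_delay t \<partial>lborel) + ((\<integral>\<^sup>+t\<in>{s..s + x}. mean_delay t \<partial>lborel)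
      + (\<integral>\<^sup>+t\<in>{s + x..C}. mean_delay t \<partial>lborel))"
    using nn_integral_split_Icc[of "\<lambda>t. ennreal (g t)" 0 s C]
      nn_integral_split_Icc[of "\<lambda>t. ennreal (g t)" s "s + x" C] s x C
    by (simp add: g_integral)
  also have "(\<integral>\<^sup>+t\<in>{0..s}. mean_delay t \<partial>lborel) = (\<integral>\<^sup>+t\<in>{0..s}. ennreal (s + delay_at_start - t) \<partial>lborel)"
    by (rule nn_integral_cong) (auto simp: mean_delay_before split: split_indicator)
  also have "\<dots> = ennreal (((s + delay_at_start)\<^sup>2 - delay_at_start\<^sup>2) / 2)"
    using set_nn_integral_linear_Icc[of 0 s "s + delay_at_start"] s delay_at_start_nonneg by simp
  also have "(\<integral>\<^sup>+t\<in>{s + x..C}. mean_delay t \<partial>lborel)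
      = (\<integral>\<^sup>+t\<in>{s + x..C}. ennreal (C + s + delay_at_start - t) \<partial>lborel)"
    by (rule nn_integral_cong) (auto simp: mean_delay_after split: split_indicator)
  also have "\<dots> = ennreal (((C - x + delay_at_start)\<^sup>2 - (s + delay_at_start)\<^sup>2) / 2)"
    using set_nn_integral_linear_Icc[of "s + x" C "C + s + delay_at_start"] s C delay_at_start_nonneg
    by (simp add: algebra_simps)
  also have "ennreal (((s + delay_at_start)\<^sup>2 - delay_at_start\<^sup>2) / 2) + ((\<integral>\<^sup>+t\<in>{s..s + x}. mean_delay t \<partial>lborel)
      + ennreal (((C - x + delay_at_start)\<^sup>2 - (s + delay_at_start)\<^sup>2) / 2))
      = ennreal (((s + delay_at_start)\<^sup>2 - delay_at_start\<^sup>2) / 2 + (x / lam + (C - x) / lam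
      + ((C - x + delay_at_start)\<^sup>2 - (s + delay_at_start)\<^sup>2) / 2))"
    unfolding set_nn_integral_during
    using s x C lam delay_at_start_nonneg by (simp add: power_mono flip: ennreal_plus)
  \<comment> \<open>The gap is split by the period boundary, but the delay is linear across it: the terms
    \<open>(s + delay_at_start)\<^sup>2\<close> cancel, and the result does not depend on \<open>s\<close>.\<close>
  also have "((s + delay_at_start)\<^sup>2 - delay_at_start\<^sup>2) / 2 + (x / lam + (C - x) / lam
      + ((C - x + delay_at_start)\<^sup>2 - (s + delay_at_start)\<^sup>2) / 2) = C / lam + (C - x) * ((C - x) / 2 + delay_at_start)"
    by (simp add: power2_eq_square add_divide_distrib diff_divide_distrib) (simp add: field_simps)
  finally show ?thesis .
qed

lemma mean_detection_time:
  "ereal (1 / C) * enn2ereal (\<integral>\<^sup>+t\<in>{0..C}.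
      (\<integral>\<^sup>+u\<in>{0..}. ennreal (exp (- lam * search_between t (t + u))) \<partial>lborel) \<partial>lborel)
    = ereal (1 / lam + (C - x) / C * (1 / lam - (C - x) / 2 + (C - x) / (1 - miss)))"
proof -
  let ?I = "C / lam + (C - x) * ((C - x) / 2 + delay_at_start)"
  have inner: "(\<integral>\<^sup>+u\<in>{0..}. ennreal (exp (- lam * search_between t (t + u))) \<partial>lborel)
      = mean_delay t" for t
    unfolding mean_delay_def
    by (subst nn_integral_real_affine[where c = 1 and t = t])
      (auto intro!: nn_integral_cong split: split_indicator)
  have "0 \<le> ?I"
    using C_pos lam C s delay_at_start_nonneg by simp
  then have "ereal (1 / C) * enn2ereal (ennreal ?I) = ereal (1 / C * ?I)"
    by simp
  also have "1 / C * ?I = 1 / lam + (C - x) / C * ((C - x) / 2 + delay_at_start)"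
    using C_pos by (simp add: distrib_left)
  finally have "ereal (1 / C) * enn2ereal (ennreal ?I)
      = ereal (1 / lam + (C - x) / C * ((C - x) / 2 + delay_at_start))" .
  moreover have "(C - x) / 2 + delay_at_start = 1 / lam - (C - x) / 2 + (C - x) / (1 - miss)"
    unfolding delay_at_start_eq using field_sum_of_halves[of "C - x"] by linarith
  ultimately show ?thesis
    unfolding inner set_nn_integral_mean_delay by (simp only:)
qed

end

section \<open>The patrol tour\<close>

lemma sum_nth_permutation:
  assumes "vs \<in> permutations_of_set A"
  shows "(\<Sum>j<length vs. f (vs ! j)) = sum f A"
  using assms sum.distinct_set_conv_list[of vs f]
  by (simp add: permutations_of_set_def sum_list_sum_nth atLeast0LessThan)

text \<open>The legs after the search of \<open>vs ! k\<close>, including the closing one, take nonnegative time. For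
  \<open>n \<ge> 2\<close> no leg is a loop, so the hypothesis on distinct locations covers them all.\<close>

lemma search_end_le_period:
  assumes "n \<ge> 2"
    and x: "\<And>i. i \<in> {1..n} \<Longrightarrow> x i > 0"
    and d: "\<And>i j. i \<in> {1..n} \<Longrightarrow> j \<in> {1..n} \<Longrightarrow> i \<noteq> j \<Longrightarrow> d i j \<ge> 0"
    and vs: "vs \<in> permutations_of_set {1..n}"
    and opt: "tour_time d vs = min_tour_time d n"
    and k: "k < length vs"
  shows "0 \<le> search_start d x vs k" "search_start d x vs k + x (vs ! k) \<le> period d n x"
proof -
  have vs': "set vs = {1..n}" "distinct vs" using vs by (auto simp: permutations_of_set_def)
  then have len: "length vs = n" using distinct_card[of vs] by simp
  have x_nth: "0 \<le> x (vs ! j)" if "j < n" for j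
    using x[of "vs ! j"] nth_mem[of j vs] that len vs' by force
  have d_nth: "0 \<le> d (vs ! j) (vs ! (Suc j mod n))" if "j < n" for j
  proof (rule d)
    have l: "Suc j mod n < n" "Suc j mod n \<noteq> j"
      using that assms(1) by (auto simp: mod_Suc)
    then show "vs ! j \<noteq> vs ! (Suc j mod n)"
      using that vs' len by (simp add: nth_eq_iff_index_eq)
    show "vs ! j \<in> {1..n}" "vs ! (Suc j mod n) \<in> {1..n}"
      using that l len vs' nth_mem by metis+
  qed
  have start: "search_start d x vs k
      = (\<Sum>j<k. x (vs ! j)) + (\<Sum>j<k. d (vs ! j) (vs ! (Suc j mod n)))"
    using k len by (auto simp: search_start_def sum.distrib intro!: sum.cong)
  show "0 \<le> search_start d x vs k"
    unfolding start by (intro add_nonneg_nonneg sum_nonneg x_nth d_nth) (use k len in simp_all)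
  have "(\<Sum>j<k. x (vs ! j)) + x (vs ! k) = (\<Sum>j<Suc k. x (vs ! j))"
    by simp
  also have "\<dots> \<le> (\<Sum>j<n. x (vs ! j))"
    by (rule sum_mono2) (use k len x_nth in auto)
  also have "\<dots> = (\<Sum>j=1..n. x j)"
    using sum_nth_permutation[OF vs, of x] len by simp
  finally have "(\<Sum>j<k. x (vs ! j)) + x (vs ! k) \<le> (\<Sum>j=1..n. x j)" .
  moreover have "(\<Sum>j<k. d (vs ! j) (vs ! (Suc j mod n))) \<le> (\<Sum>j<n. d (vs ! j) (vs ! (Suc j mod n)))"
    by (rule sum_mono2) (use k len d_nth in auto)
  then have "(\<Sum>j<k. d (vs ! j) (vs ! (Suc j mod n))) \<le> min_tour_time d n"
    using opt len by (simp add: tour_time_def)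
  ultimately show "search_start d x vs k + x (vs ! k) \<le> period d n x"
    by (simp add: start period_def)
qed

theorem mainTheorem3:
  fixes n :: nat and d :: "nat \<Rightarrow> nat \<Rightarrow> real" and lam x :: "nat \<Rightarrow> real" and vs :: "nat list"
  assumes "n \<ge> 2"
    and "\<And>i. i \<in> {1..n} \<Longrightarrow> lam i > 0"
    and "\<And>i. i \<in> {1..n} \<Longrightarrow> x i > 0"
    and "\<And>i j. i \<in> {1..n} \<Longrightarrow> j \<in> {1..n} \<Longrightarrow> i \<noteq> j \<Longrightarrow> d i j \<ge> 0"
    and "min_tour_time d n > 0"
    and "vs \<in> permutations_of_set {1..n}"
    and "tour_time d vs = min_tour_time d n"
    and "i \<in> {1..n}"
  shows "expected_detection_time d n lam x vs i =
    ereal (1 / lam i + (period d n x - x i) / period d n x *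
      (1 / lam i - (period d n x - x i) / 2
        + (period d n x - x i) / (1 - exp (- lam i * x i))))"
proof -
  have vs: "set vs = {1..n}" "distinct vs"
    using assms(6) by (auto simp: permutations_of_set_def)
  then obtain k where k: "k < length vs" "vs ! k = i"
    using assms(8) by (metis in_set_conv_nth)
  then have unique: "{k. k < length vs \<and> vs ! k = i} = {k}"
    using vs(2) by (auto simp: nth_eq_iff_index_eq)
  interpret periodic_search "period d n x" "search_start d x vs k" "x i" "lam i"
    using search_end_le_period[OF assms(1,3,4,6,7) k(1)] k(2) assms(2,3,8)
    by unfold_locales simp_all
  have "search_time d n x vs i a b = search_between a b" for a b
    by (simp add: search_time_def searched_def unique search_between_def searching_def start_def)
  then show ?thesis
    using mean_detection_time by (simp add: expected_detection_time_def)
qed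

end
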